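(* Let $\mathbb{K}$ be a field and let $k\ge 1$ be an integer. Every invariant chain $I_1^{\pm}\subseteq I_2^{\pm}\subseteq\cdots$ of Laurent lattice ideals $I_n^{\pm}\subseteq \mathcal{R}_n^{\pm}$ stabilizes. Likewise, every invariant chain $I_1^{\pm}\subseteq I_2^{\pm}\subseteq\cdots$ of Laurent lattice ideals $I_n^{\pm}\subseteq R_n^{\pm}$ stabilizes.
   Context: Let $\mathbb{P}=\{1,2,3,\dots\}$, $\mathbb{N}=\{0,1,2,\dots\}$ and $[n]=\{1,\dots,n\}$. Let $[n]^k$ be the set of all ordered $k$-tuples of elements of $[n]$, and $\langle n\rangle^k\subseteq[n]^k$ the subset of $k$-tuples with pairwise distinct entries. For $n\le m$ we have $[n]^k\subseteq[m]^k$ and $\langle n\rangle^k\subseteq\langle m\rangle^k$. Rings: $\mathcal{R}_n=\mathbb{K}[x_u : u\in[n]^k]$ and $R_n=\mathbb{K}[x_u : u\in\langle n\rangle^k]$ are polynomial rings, with $\mathcal{R}_n\subseteq\mathcal{R}_m$ and $R_n\subseteq R_m$ for $n\le m$. For a polynomial ring $R$ over $\mathbb{K}$, $R^{\pm}$ denotes its localization at the multiplicative set of all monomials (the Laurent polynomial ring), and for an ideal $I\subseteq R$, $I^{\pm}=\{g h^{-1}: g\in I,\ h \text{ a monomial of } R\}\subseteq R^{\pm}$. Group action: $\mathfrak{S}_n$, the group of permutations of $[n]$, is embedded in $\mathfrak{S}_m$ for $n\le m$ in the natural way (fixing the elements larger than $n$). It acts on $k$-tuples by $\sigma(u_1,\dots,u_k)=(\sigma(u_1),\dots,\sigma(u_k))$,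 hence on $\mathcal{R}_n$, $R_n$ and their Laurent rings by $\mathbb{K}$-algebra automorphisms with $\sigma x_u=x_{\sigma u}$. Lattice ideals: for a subgroup $L\subseteq\mathbb{Z}^d$ (equivalently, the kernel of a surjection from $\mathbb{Z}^d$ onto a finitely generated abelian group), the lattice ideal of $L$ is $I_L=\langle \mathbf{z}^u-\mathbf{z}^v : u,v\in\mathbb{N}^d,\ u-v\in L\rangle\subseteq\mathbb{K}[z_1,\dots,z_d]$. A Laurent lattice ideal is an ideal of the form $I^{\pm}$ with $I$ a lattice ideal (here in the polynomial ring $\mathcal{R}_n$, respectively $R_n$, with its indeterminates playing the role of $z_1,\dots,z_d$). Chains: writing $Q_n$ for $\mathcal{R}_n^{\pm}$ (respectively $R_n^{\pm}$), a chain of ideals $J_1\subseteq J_2\subseteq\cdots$ with $J_n\subseteq Q_n$ is an invariant chain if $\mathfrak{S}_m J_n\subseteq J_m$ for all $m\ge n$, where $\mathfrak{S}_mJ_n=\{\sigma g:\sigma\in\mathfrak{S}_m, g\in J_n\}$. An invariant chain stabilizes if there is an integer $N$ such that for all $m\ge N$ the ideal of $Q_m$ generated by $\mathfrak{S}_mJ_N$ equals $J_m$. *)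

theory Defs
  imports "HOL-Library.Poly_Mapping" "HOL-Algebra.Ideal" "HOL-Combinatorics.Permutations"
begin

section \<open>Polynomial and Laurent polynomial rings\<close>

text \<open>
  An exponent vector is a finitely supported function \<open>'v \<Rightarrow>\<^sub>0 int\<close>, and a Laurent polynomial
  over \<open>'a\<close> is a finitely supported function from exponent vectors to \<open>'a\<close>. The product of the
  type \<open>('v, 'a) laurent\<close> is convolution (HOL-Library.Poly_Mapping), so that
  \<open>Poly_Mapping.single e c\<close> is the term \<open>c x\<^sup>e\<close>. All rings below are subrings of this one
  commutative ring, so that the inclusions between polynomial rings, between Laurent polynomial
  rings, and of a polynomial ring in its localization at the monomials, are inclusions of sets.
\<close>

type_synonym ('v, 'a) laurent = "('v \<Rightarrow>\<^sub>0 int) \<Rightarrow>\<^sub>0 'a"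

definition exponents :: "'v set \<Rightarrow> ('v \<Rightarrow>\<^sub>0 int) set" where
  "exponents V = {e. Poly_Mapping.keys e \<subseteq> V}"

definition nonneg_exponents :: "'v set \<Rightarrow> ('v \<Rightarrow>\<^sub>0 int) set" where
  "nonneg_exponents V = {e \<in> exponents V. \<forall>v. 0 \<le> Poly_Mapping.lookup e v}"

definition exponent_group :: "'v set \<Rightarrow> ('v \<Rightarrow>\<^sub>0 int) monoid" where
  "exponent_group V = \<lparr>carrier = exponents V, monoid.mult = (+), one = 0\<rparr>"

definition monoid_algebra :: "('v \<Rightarrow>\<^sub>0 int) set \<Rightarrow> ('v, 'a::field) laurent ring" where
  "monoid_algebra E =
     \<lparr>carrier = {p. Poly_Mapping.keys p \<subseteq> E}, monoid.mult = (*), one = 1, zero = 0, add = (+)\<rparr>"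

definition poly_ring :: "'v set \<Rightarrow> ('v, 'a::field) laurent ring" where
  "poly_ring V = monoid_algebra (nonneg_exponents V)"

definition laurent_ring :: "'v set \<Rightarrow> ('v, 'a::field) laurent ring" where
  "laurent_ring V = monoid_algebra (exponents V)"

definition monomial :: "('v \<Rightarrow>\<^sub>0 int) \<Rightarrow> ('v, 'a::field) laurent" where
  "monomial e = Poly_Mapping.single e 1"

lemma monomial_mult: "monomial d * monomial e = (monomial (d + e) :: ('v, 'a::field) laurent)"
  by (simp add: monomial_def mult_single)

lemma monomial_inverse: "monomial e * monomial (- e) = (1 :: ('v, 'a::field) laurent)"
  by (simp add: monomial_def mult_single)

lemma comm_group_exponent_group: "comm_group (exponent_group V)"
proof (rule comm_groupI)
  fix x assume "x \<in> carrier (exponent_group V)"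
  then show "\<exists>y\<in>carrier (exponent_group V).
      y \<otimes>\<^bsub>exponent_group V\<^esub> x = \<one>\<^bsub>exponent_group V\<^esub>"
    by (intro bexI[of _ "- x"]) (auto simp: exponent_group_def exponents_def)
qed (use keys_add in \<open>force simp: exponent_group_def exponents_def add_ac\<close>)+

lemma cring_monoid_algebra:
  assumes "0 \<in> E" and "\<And>d e. d \<in> E \<Longrightarrow> e \<in> E \<Longrightarrow> d + e \<in> E"
  shows "cring (monoid_algebra E :: ('v, 'a::field) laurent ring)"
proof (rule cringI)
  show "abelian_group (monoid_algebra E :: ('v, 'a) laurent ring)"
  proof (rule abelian_groupI)
    fix p :: "('v, 'a) laurent" assume p: "p \<in> carrier (monoid_algebra E)"
    have "Poly_Mapping.keys (- p) = Poly_Mapping.keys p"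
      by (auto simp: in_keys_iff)
    with p show "\<exists>q\<in>carrier (monoid_algebra E).
        q \<oplus>\<^bsub>monoid_algebra E\<^esub> p = \<zero>\<^bsub>monoid_algebra E\<^esub>"
      by (intro bexI[of _ "- p"]) (auto simp: monoid_algebra_def)
  qed (use Poly_Mapping.keys_add in \<open>force simp: monoid_algebra_def add_ac\<close>)+
  show "Group.comm_monoid (monoid_algebra E :: ('v, 'a) laurent ring)"
  proof (rule comm_monoidI)
    fix p q :: "('v, 'a) laurent"
    assume "p \<in> carrier (monoid_algebra E)" "q \<in> carrier (monoid_algebra E)"
    then show "p \<otimes>\<^bsub>monoid_algebra E\<^esub> q \<in> carrier (monoid_algebra E)"
      using keys_mult[of p q] assms(2) by (fastforce simp: monoid_algebra_def)
  qed (use assms(1) in \<open>auto simp: monoid_algebra_def mult_ac\<close>)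
qed (auto simp: monoid_algebra_def distrib_right)

lemma cring_laurent_ring: "cring (laurent_ring V :: ('v, 'a::field) laurent ring)"
  unfolding laurent_ring_def
  by (rule cring_monoid_algebra) (use keys_add in \<open>force simp: exponents_def\<close>)+

lemma cring_poly_ring: "cring (poly_ring V :: ('v, 'a::field) laurent ring)"
  unfolding poly_ring_def
  by (rule cring_monoid_algebra)
     (use keys_add in \<open>force simp: nonneg_exponents_def exponents_def lookup_add\<close>)+


section \<open>Lattice ideals\<close>

definition lattice_ideal ::
    "'v set \<Rightarrow> ('v \<Rightarrow>\<^sub>0 int) set \<Rightarrow> ('v, 'a::field) laurent set" where
  "lattice_ideal V L =
     Idl\<^bsub>poly_ring V\<^esub> {monomial u - monomial v | u v.
       u \<in> nonneg_exponents V \<and> v \<in> nonneg_exponents V \<and> u - v \<in> L}"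

text \<open>The set \<open>I\<^sup>\<plusminus> = {g h\<^sup>-\<^sup>1}\<close>, where \<open>h\<close> runs over the monomials of the polynomial ring.\<close>

definition laurent_extension ::
    "'v set \<Rightarrow> ('v, 'a::field) laurent set \<Rightarrow> ('v, 'a) laurent set" where
  "laurent_extension V I = {g * monomial (- e) | g e. g \<in> I \<and> e \<in> nonneg_exponents V}"

definition laurent_lattice_ideal :: "'v set \<Rightarrow> ('v, 'a::field) laurent set \<Rightarrow> bool" where
  "laurent_lattice_ideal V J \<longleftrightarrow>
     (\<exists>L. subgroup L (exponent_group V) \<and> J = laurent_extension V (lattice_ideal V L))"


section \<open>Tuples and the action of the symmetric groups\<close>

definition tuples :: "nat \<Rightarrow> nat \<Rightarrow> nat list set" where
  "tuples k n = {u. length u = k \<and> set u \<subseteq> {1..n}}"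

definition distinct_tuples :: "nat \<Rightarrow> nat \<Rightarrow> nat list set" where
  "distinct_tuples k n = {u \<in> tuples k n. distinct u}"

text \<open>
  \<open>perm_exponent \<sigma>\<close> is the \<open>\<int>\<close>-linear map with \<open>e\<^sub>u \<mapsto> e\<^bsub>\<sigma> u\<^esub>\<close>, and \<open>perm_act \<sigma>\<close> is the linear map
  with \<open>x\<^sup>e \<mapsto> x\<^bsup>\<sigma> e\<^esup>\<close>. An element of the symmetric group of \<open>{1..n}\<close> is a function \<open>\<sigma>\<close> with
  \<open>\<sigma> permutes {1..n}\<close>; it fixes all numbers outside \<open>{1..n}\<close>, so the embeddings of the symmetric
  groups into one another are inclusions.
\<close>

definition perm_exponent :: "(nat \<Rightarrow> nat) \<Rightarrow> (nat list \<Rightarrow>\<^sub>0 int) \<Rightarrow> (nat list \<Rightarrow>\<^sub>0 int)" where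
  "perm_exponent \<sigma> e = frag_extend (\<lambda>u. frag_of (map \<sigma> u)) e"

definition perm_act ::
    "(nat \<Rightarrow> nat) \<Rightarrow> (nat list, 'a::field) laurent \<Rightarrow> (nat list, 'a) laurent" where
  "perm_act \<sigma> p =
     (\<Sum>e\<in>Poly_Mapping.keys p.
        Poly_Mapping.single (perm_exponent \<sigma> e) (Poly_Mapping.lookup p e))"

lemma perm_act_single:
  "perm_act \<sigma> (Poly_Mapping.single e c) = Poly_Mapping.single (perm_exponent \<sigma> e) c"
  by (simp add: perm_act_def)

lemma perm_act_var: "perm_act \<sigma> (monomial (frag_of u)) = monomial (frag_of (map \<sigma> u))"
  by (simp add: monomial_def perm_act_single perm_exponent_def)

lemma perm_act_superset:
  assumes "finite A" "Poly_Mapping.keys p \<subseteq> A"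
  shows "perm_act \<sigma> p =
    (\<Sum>e\<in>A. Poly_Mapping.single (perm_exponent \<sigma> e) (Poly_Mapping.lookup p e))"
  unfolding perm_act_def using assms
  by (intro sum.mono_neutral_left) (auto simp: in_keys_iff)

lemma perm_act_add: "perm_act \<sigma> (p + q) = perm_act \<sigma> p + perm_act \<sigma> q"
proof -
  define A where "A = Poly_Mapping.keys p \<union> Poly_Mapping.keys q"
  have "finite A" "Poly_Mapping.keys p \<subseteq> A" "Poly_Mapping.keys q \<subseteq> A"
    "Poly_Mapping.keys (p + q) \<subseteq> A"
    using Poly_Mapping.keys_add[of p q] by (auto simp: A_def)
  then show ?thesis
    by (simp add: perm_act_superset[of A] lookup_add single_add sum.distrib)
qed

lemma perm_act_mult: "perm_act \<sigma> (p * q) = perm_act \<sigma> p * perm_act \<sigma> q"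
proof -
  have base: "perm_act \<sigma> (Poly_Mapping.single d a * Poly_Mapping.single e b) =
      perm_act \<sigma> (Poly_Mapping.single d a) * perm_act \<sigma> (Poly_Mapping.single e b)"
    for d e and a b :: 'a
    by (simp add: mult_single perm_act_single perm_exponent_def frag_extend_add)
  have 0: "perm_act \<sigma> 0 = (0 :: (nat list, 'a) laurent)"
    by (simp add: perm_act_def)
  have sums: "perm_act \<sigma> (sum f A) = (\<Sum>i\<in>A. perm_act \<sigma> (f i))"
    for f :: "(nat list \<Rightarrow>\<^sub>0 int) \<Rightarrow> (nat list, 'a) laurent" and A
    by (induction A rule: infinite_finite_induct) (simp_all add: 0 perm_act_add)
  have expand: "r = (\<Sum>e\<in>Poly_Mapping.keys r. Poly_Mapping.single e (Poly_Mapping.lookup r e))"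
    for r :: "(nat list, 'a) laurent"
    by (rule poly_mapping_eqI) (auto simp: lookup_sum lookup_single when_def in_keys_iff)
  have "perm_act \<sigma> ((\<Sum>d\<in>A. Poly_Mapping.single d (f d)) * (\<Sum>e\<in>B. Poly_Mapping.single e (g e))) =
      perm_act \<sigma> (\<Sum>d\<in>A. Poly_Mapping.single d (f d)) *
      perm_act \<sigma> (\<Sum>e\<in>B. Poly_Mapping.single e (g e))"
    for A B and f g :: "(nat list \<Rightarrow>\<^sub>0 int) \<Rightarrow> 'a"
    by (simp only: sum_product sums base)
  from this[of "Poly_Mapping.lookup p" "Poly_Mapping.keys p"
               "Poly_Mapping.lookup q" "Poly_Mapping.keys q"]
  show ?thesis
    by (simp only: expand[symmetric])
qed


section \<open>Invariant chains\<close>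

text \<open>Chains are indexed by the positive integers; the value of \<open>J\<close> at \<open>0\<close> plays no role.\<close>

definition invariant_chain ::
    "(nat \<Rightarrow> (nat list, 'a::field) laurent ring) \<Rightarrow>
     (nat \<Rightarrow> (nat list, 'a) laurent set) \<Rightarrow> bool" where
  "invariant_chain Q J \<longleftrightarrow>
     (\<forall>n\<ge>1. ideal (J n) (Q n)) \<and>
     (\<forall>n\<ge>1. J n \<subseteq> J (Suc n)) \<and>
     (\<forall>n\<ge>1. \<forall>m\<ge>n. \<forall>\<sigma>. \<sigma> permutes {1..m} \<longrightarrow> perm_act \<sigma> ` J n \<subseteq> J m)"

definition stabilizes ::
    "(nat \<Rightarrow> (nat list, 'a::field) laurent ring) \<Rightarrow>
     (nat \<Rightarrow> (nat list, 'a) laurent set) \<Rightarrow> bool" where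
  "stabilizes Q J \<longleftrightarrow>
     (\<exists>N\<ge>1. \<forall>m\<ge>N. Idl\<^bsub>Q m\<^esub> {perm_act \<sigma> g | \<sigma> g. \<sigma> permutes {1..m} \<and> g \<in> J N} = J m)"

end

theory Submission
  imports Complex_Main Defs "HOL-Library.List_Lexorder"
begin

text \<open>
  In a Laurent ring monomials are units, so a binomial \<open>x\<^sup>u - x\<^sup>v\<close> generates the same ideal as
  \<open>x\<^bsup>u-v\<^esup> - 1\<close>. A Laurent lattice ideal \<open>J\<close> is therefore generated by the elements \<open>x\<^sup>e - 1\<close> it
  contains, and their exponents \<open>e\<close> form a subgroup of the exponent group, the lattice of \<open>J\<close>
  (\<open>ideal_lattice\<close>). An invariant chain of ideals gives an invariant chain of such subgroups
  \<open>L\<^sub>n\<close>, and it is enough to find \<open>N\<close> such that for \<open>m \<ge> N\<close> the translates of \<open>L\<^sub>N\<close> under the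
  permutations of \<open>{1..m}\<close> generate the group \<open>L\<^sub>m\<close> (\<open>lattice_chain_stabilizes\<close>). This is a
  statement about integer vectors only, and it covers both kinds of tuples at once, because vectors
  supported on tuples with distinct entries are in particular supported on tuples.

  The lattice statement is proved in the manner of Groebner bases. Tuples are ordered
  lexicographically; this order is preserved by every strictly increasing map \<open>\<pi>\<close> of the entries.
  Suppose that no \<open>N\<close> works. For each \<open>N\<close> there are then \<open>m \<ge> N\<close> and a vector \<open>f\<close> of \<open>L\<^sub>m\<close> outside a
  subgroup \<open>H\<close> that contains all translates of \<open>L\<^sub>N\<close>. Choose \<open>f\<close> with least leading tuple \<open>v\<close> and,
  among these, with leading coefficient \<open>c\<close> of least absolute value
  (\<open>minimal_missing_element\<close>). Dickson's lemma, applied to \<open>\<bar>c\<bar>\<close> and to the differences between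
  the numbers \<open>0\<close>, \<open>m + 1\<close> and the entries of \<open>v\<close>, yields two stages \<open>p\<close> and \<open>q\<close>, with \<open>q\<close> as late as
  desired, such that \<open>\<bar>c\<^sub>p\<bar> \<le> \<bar>c\<^sub>q\<bar>\<close> and some strictly increasing map \<open>\<pi>\<close> from \<open>{1..m\<^sub>p}\<close> to
  \<open>{1..m\<^sub>q}\<close> takes \<open>v\<^sub>p\<close> to \<open>v\<^sub>q\<close> (\<open>strict_mono_between_tuples\<close>). Extend \<open>\<pi>\<close> to a permutation
  \<open>\<sigma>\<close>. The vector \<open>\<sigma> f\<^sub>p\<close> lies in \<open>H\<^sub>q\<close> and has leading term \<open>c\<^sub>p\<close> at \<open>v\<^sub>q\<close>, so one of
  \<open>f\<^sub>q - \<sigma> f\<^sub>p\<close> and \<open>f\<^sub>q + \<sigma> f\<^sub>p\<close> is a smaller element of \<open>L\<close> outside \<open>H\<^sub>q\<close>, a contradiction.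
\<close>

section \<open>Dickson's lemma and strictly increasing maps\<close>

lemma nat_seq_mono_subseq:
  fixes s :: "nat \<Rightarrow> nat"
  shows "\<exists>\<phi> :: nat \<Rightarrow> nat. strict_mono \<phi> \<and> mono (s \<circ> \<phi>)"
proof -
  obtain \<phi> where \<phi>: "strict_mono \<phi>" "monoseq (\<lambda>i. s (\<phi> i))"
    using seq_monosub by blast
  show ?thesis
  proof (cases "mono (s \<circ> \<phi>)")
    case True
    with \<phi> show ?thesis by blast
  next
    case False
    with \<phi>(2) have dec: "s (\<phi> j) \<le> s (\<phi> i)" if "i \<le> j" for i j
      using that by (auto simp: monoseq_def mono_def)
    obtain l where l: "\<And>i. s (\<phi> l) \<le> s (\<phi> i)"
      using ex_has_least_nat[of "\<lambda>_. True" 0 "\<lambda>i. s (\<phi> i)"] by auto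
    have "s (\<phi> (l + i)) = s (\<phi> l)" for i
      using dec[of l "l + i"] l[of "l + i"] by simp
    then have "mono (s \<circ> (\<lambda>i. \<phi> (l + i)))"
      by (simp add: mono_def)
    moreover have "strict_mono (\<lambda>i. \<phi> (l + i))"
      using \<phi>(1) by (simp add: strict_mono_def)
    ultimately show ?thesis by blast
  qed
qed

text \<open>
  Dickson's lemma in its subsequence form: thin out the sequence once for each coordinate. The
  subsequence form (rather than a single good pair) is needed because the later index of the pair
  must be chosen large in terms of the data attached to the earlier one.
\<close>

lemma dickson_subseq:
  fixes f :: "nat \<Rightarrow> 'i \<Rightarrow> nat"
  assumes "finite I"
  shows "\<exists>\<phi> :: nat \<Rightarrow> nat. strict_mono \<phi> \<and> (\<forall>i\<in>I. \<forall>s t. s \<le> t \<longrightarrow> f (\<phi> s) i \<le> f (\<phi> t) i)"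
  using assms
proof (induction I rule: finite_induct)
  case empty
  show ?case by (intro exI[of _ id]) (simp add: strict_mono_def)
next
  case (insert a I)
  then obtain \<phi> :: "nat \<Rightarrow> nat" where \<phi>: "strict_mono \<phi>"
    "\<forall>i\<in>I. \<forall>s t. s \<le> t \<longrightarrow> f (\<phi> s) i \<le> f (\<phi> t) i" by blast
  obtain \<psi> :: "nat \<Rightarrow> nat" where \<psi>: "strict_mono \<psi>" "mono ((\<lambda>s. f (\<phi> s) a) \<circ> \<psi>)"
    using nat_seq_mono_subseq by blast
  have "strict_mono (\<phi> \<circ> \<psi>)"
    using \<phi>(1) \<psi>(1) by (rule strict_mono_o)
  moreover have "f ((\<phi> \<circ> \<psi>) s) i \<le> f ((\<phi> \<circ> \<psi>) t) i" if "i \<in> insert a I" "s \<le> t" for i s t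
  proof -
    have "\<psi> s \<le> \<psi> t"
      using \<psi>(1) that(2) by (simp add: strict_mono_less_eq)
    then show ?thesis
      using \<phi>(2) \<psi>(2) that by (auto simp: mono_def)
  qed
  ultimately show ?case by blast
qed

text \<open>
  The truncated difference \<open>Suc (a j) - a i\<close> is positive exactly if \<open>a i \<le> a j\<close>. The single
  inequality \<open>gaps\<close> thus says both that \<open>b\<close> preserves the weak order of the values of \<open>a\<close> (in
  particular coincidences) and that no gap shrinks, and it has the form that Dickson's lemma
  delivers. The map moves each \<open>x\<close> as far as some value \<open>a i \<le> x\<close> forces it to move; as a maximum of
  shifts over an index set that grows with \<open>x\<close>, it is strictly increasing.
\<close>

lemma strict_mono_interpolation:
  fixes a b :: "'i \<Rightarrow> nat"
  assumes "finite I" "i0 \<in> I" "a i0 = 0"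
    and gaps: "\<And>i j. i \<in> I \<Longrightarrow> j \<in> I \<Longrightarrow> Suc (a j) - a i \<le> Suc (b j) - b i"
  shows "\<exists>\<pi>. strict_mono \<pi> \<and> (\<forall>i\<in>I. \<pi> (a i) = b i)"
proof -
  define S where "S x = (\<lambda>i. b i + (x - a i)) ` {i \<in> I. a i \<le> x}" for x
  define \<pi> where "\<pi> x = Max (S x)" for x
  have fin: "finite (S x)" and ne: "S x \<noteq> {}" for x
    using assms(1-3) by (auto simp: S_def)
  have "\<pi> x < \<pi> y" if "x < y" for x y
  proof -
    have "\<pi> x \<in> S x"
      unfolding \<pi>_def using fin ne by (rule Max_in)
    then obtain i where i: "i \<in> I" "a i \<le> x" "\<pi> x = b i + (x - a i)"
      by (auto simp: S_def)
    with that have "b i + (y - a i) \<in> S y"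
      by (auto simp: S_def)
    then have "b i + (y - a i) \<le> \<pi> y"
      unfolding \<pi>_def using fin by simp
    with i that show ?thesis by linarith
  qed
  moreover have "\<pi> (a j) = b j" if "j \<in> I" for j
    unfolding \<pi>_def
  proof (rule Max_eqI)
    show "b j \<in> S (a j)"
      using that unfolding S_def by (intro image_eqI[of _ _ j]) auto
    show "z \<le> b j" if "z \<in> S (a j)" for z
    proof -
      from that obtain i where i: "i \<in> I" "a i \<le> a j" "z = b i + (a j - a i)"
        by (auto simp: S_def)
      with gaps[OF i(1) \<open>j \<in> I\<close>] show ?thesis by linarith
    qed
  qed (rule fin)
  ultimately show ?thesis
    unfolding strict_mono_def by blast
qed

text \<open>
  The entries of a tuple over \<open>{1..n}\<close> together with the two walls \<open>0\<close> and \<open>n + 1\<close>. A strictly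
  increasing map that respects the walls maps \<open>{1..n}\<close> into the interval between the new walls.
\<close>

definition landmark :: "nat \<Rightarrow> nat list \<Rightarrow> nat \<Rightarrow> nat" where
  "landmark n u i = (0 # Suc n # u) ! i"

lemma strict_mono_between_tuples:
  assumes u: "length u = k" and v: "length v = k"
    and gaps: "\<And>i j. i < k + 2 \<Longrightarrow> j < k + 2 \<Longrightarrow>
      Suc (landmark n u j) - landmark n u i \<le> Suc (landmark m v j) - landmark m v i"
  shows "\<exists>\<pi>. strict_mono \<pi> \<and> \<pi> ` {1..n} \<subseteq> {1..m} \<and> map \<pi> u = v"
proof -
  obtain \<pi> where \<pi>: "strict_mono \<pi>" "\<And>i. i < k + 2 \<Longrightarrow> \<pi> (landmark n u i) = landmark m v i"
    using strict_mono_interpolation[of "{..<k+2}" 0 "landmark n u" "landmark m v"] gaps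
    by (auto simp: landmark_def)
  have top: "\<pi> (Suc n) = Suc m"
    using \<pi>(2)[of 1] by (simp add: landmark_def)
  have "\<pi> ` {1..n} \<subseteq> {1..m}"
  proof
    fix y assume "y \<in> \<pi> ` {1..n}"
    then obtain x where x: "1 \<le> x" "x \<le> n" "y = \<pi> x" by auto
    have "\<pi> x < \<pi> (Suc n)"
      using \<pi>(1) x(2) by (simp add: strict_mono_less)
    with x top strict_mono_imp_increasing[OF \<pi>(1), of x] show "y \<in> {1..m}"
      by auto
  qed
  moreover have "map \<pi> u = v"
  proof (rule nth_equalityI)
    fix i assume "i < length (map \<pi> u)"
    with u v show "map \<pi> u ! i = v ! i"
      using \<pi>(2)[of "i + 2"] by (simp add: landmark_def)
  qed (use u v in simp)
  ultimately show ?thesis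
    using \<pi>(1) by blast
qed

lemma injection_extends_to_permutation:
  fixes \<pi> :: "'a \<Rightarrow> 'a"
  assumes "finite B" "A \<subseteq> B" "inj_on \<pi> A" "\<pi> ` A \<subseteq> B"
  shows "\<exists>\<sigma>. \<sigma> permutes B \<and> (\<forall>x\<in>A. \<sigma> x = \<pi> x)"
proof -
  have "card (B - A) = card (B - \<pi> ` A)"
    using assms by (simp add: card_Diff_subset card_image finite_subset)
  then obtain h where h: "bij_betw h (B - A) (B - \<pi> ` A)"
    using assms(1) by (meson finite_same_card_bij finite_Diff)
  define \<sigma> where "\<sigma> x = (if x \<in> A then \<pi> x else if x \<in> B then h x else x)" for x
  have "bij_betw \<sigma> A (\<pi> ` A)"
    using assms(3) by (auto simp: bij_betw_def \<sigma>_def inj_on_def)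
  moreover have "bij_betw \<sigma> (B - A) (B - \<pi> ` A)"
    using h by (rule bij_betw_cong[THEN iffD1, rotated]) (simp add: \<sigma>_def)
  ultimately have "bij_betw \<sigma> (A \<union> (B - A)) (\<pi> ` A \<union> (B - \<pi> ` A))"
    by (rule bij_betw_combine) auto
  then have "bij_betw \<sigma> B B"
    using assms(2,4) by (simp add: Un_absorb1)
  then have "\<sigma> permutes B"
    by (rule bij_imp_permutes) (use assms(2) in \<open>auto simp: \<sigma>_def\<close>)
  then show ?thesis
    by (auto simp: \<sigma>_def)
qed

lemma map_strict_mono_less:
  fixes \<pi> :: "nat \<Rightarrow> nat" and u v :: "nat list"
  assumes "strict_mono \<pi>" "u < v"
  shows "map \<pi> u < map \<pi> v"
  using assms(2) unfolding list_less_def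
proof (induction u arbitrary: v)
  case Nil
  then show ?case by (cases v) auto
next
  case (Cons a u)
  then show ?case
    using assms(1) by (cases v) (auto simp: strict_mono_less)
qed

lemma map_strict_mono_le:
  fixes \<pi> :: "nat \<Rightarrow> nat" and u v :: "nat list"
  assumes "strict_mono \<pi>" "u \<le> v"
  shows "map \<pi> u \<le> map \<pi> v"
  using assms map_strict_mono_less[of \<pi> u v] by (auto simp: order.order_iff_strict)

section \<open>Permutations acting on exponent vectors\<close>

lemma finite_tuples: "finite (tuples k n)"
  using finite_lists_length_eq[of "{1..n}" k] by (simp add: tuples_def conj_commute)

lemma keys_perm_exponent:
  "Poly_Mapping.keys (perm_exponent \<sigma> e) \<subseteq> map \<sigma> ` Poly_Mapping.keys e"
  unfolding perm_exponent_def using keys_frag_extend by fastforce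

lemma lookup_perm_exponent:
  assumes "inj \<sigma>"
  shows "Poly_Mapping.lookup (perm_exponent \<sigma> e) (map \<sigma> u) = Poly_Mapping.lookup e u"
proof -
  have "Poly_Mapping.lookup (perm_exponent \<sigma> e) (map \<sigma> u) =
      (\<Sum>v\<in>Poly_Mapping.keys e. if v = u then Poly_Mapping.lookup e v else 0)"
    unfolding perm_exponent_def frag_extend_def lookup_sum
    by (intro sum.cong) (auto simp: when_def inj_map_eq_map[OF assms])
  also have "\<dots> = Poly_Mapping.lookup e u"
    by (simp add: in_keys_iff)
  finally show ?thesis .
qed

lemma perm_exponent_id: "perm_exponent id e = e"
  by (simp add: perm_exponent_def flip: frag_expansion)

section \<open>Invariant chains of lattices\<close>

definition add_subgroup :: "'b::ab_group_add set \<Rightarrow> bool" where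
  "add_subgroup H \<longleftrightarrow> 0 \<in> H \<and> (\<forall>a\<in>H. \<forall>b\<in>H. a - b \<in> H)"

lemma add_subgroup_neg: "add_subgroup H \<Longrightarrow> a \<in> H \<Longrightarrow> - a \<in> H"
  unfolding add_subgroup_def by (metis diff_0)

lemma add_subgroup_add: "add_subgroup H \<Longrightarrow> a \<in> H \<Longrightarrow> b \<in> H \<Longrightarrow> a + b \<in> H"
  using add_subgroup_neg[of H b] unfolding add_subgroup_def by (metis diff_minus_eq_add)

definition lead :: "('v::linorder \<Rightarrow>\<^sub>0 int) \<Rightarrow> 'v" where
  "lead e = Max (Poly_Mapping.keys e)"

lemma lead_in_keys: "e \<noteq> 0 \<Longrightarrow> lead e \<in> Poly_Mapping.keys e"
  unfolding lead_def by (intro Max_in) auto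

text \<open>
  The lexicographic order of lists is not well-founded, so the least leading tuple exists only
  because \<open>X\<close> is finite. In the conclusion the comparison is with all \<open>h\<close> supported below the leading
  tuple of \<open>f\<close>: such an \<open>h\<close> has the same leading tuple, by minimality of that tuple.
\<close>

lemma minimal_missing_element:
  fixes A H :: "('v::linorder \<Rightarrow>\<^sub>0 int) set"
  assumes "\<not> A \<subseteq> H" "A \<subseteq> exponents X" "finite X" "0 \<in> H"
  shows "\<exists>f\<in>A - H. f \<noteq> 0 \<and> (\<forall>h\<in>A - H. Poly_Mapping.keys h \<subseteq> {..lead f} \<longrightarrow>
    \<bar>Poly_Mapping.lookup f (lead f)\<bar> \<le> \<bar>Poly_Mapping.lookup h (lead f)\<bar>)"
proof -
  have lead_X: "lead f \<in> X" if "f \<in> A - H" for f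
    using lead_in_keys[of f] that assms(2,4) by (auto simp: exponents_def)
  then have fin: "finite (lead ` (A - H))"
    using assms(3) by (meson finite_subset image_subsetI)
  define v where "v = Min (lead ` (A - H))"
  have "v \<in> lead ` (A - H)"
    unfolding v_def using fin assms(1) by (intro Min_in) auto
  then obtain f0 where "f0 \<in> A - H" "lead f0 = v" by auto
  then obtain f where f: "f \<in> A - H" "lead f = v"
    and least: "\<And>h. h \<in> A - H \<Longrightarrow> lead h = v \<Longrightarrow>
      nat \<bar>Poly_Mapping.lookup f v\<bar> \<le> nat \<bar>Poly_Mapping.lookup h v\<bar>"
    using ex_has_least_nat[of "\<lambda>f. f \<in> A - H \<and> lead f = v" f0
        "\<lambda>f. nat \<bar>Poly_Mapping.lookup f v\<bar>"] by blast
  have "\<bar>Poly_Mapping.lookup f v\<bar> \<le> \<bar>Poly_Mapping.lookup h v\<bar>"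
    if h: "h \<in> A - H" "Poly_Mapping.keys h \<subseteq> {..v}" for h
  proof -
    have "h \<noteq> 0"
      using h(1) assms(4) by auto
    then have "lead h \<le> v"
      using lead_in_keys h(2) by auto
    moreover have "v \<le> lead h"
      unfolding v_def using fin h(1) by simp
    ultimately show ?thesis
      using least[OF h(1)] by simp
  qed
  moreover have "f \<noteq> 0"
    using f(1) assms(4) by auto
  ultimately show ?thesis
    using f by auto
qed

text \<open>
  The subgroup generated by the translates of \<open>L N\<close> enters through its universal property: every
  \<open>H\<close> that contains the translates contains \<open>L m\<close>.
\<close>

theorem lattice_chain_stabilizes:
  fixes L :: "nat \<Rightarrow> (nat list \<Rightarrow>\<^sub>0 int) set"
  assumes grp: "\<And>n. n \<ge> 1 \<Longrightarrow> add_subgroup (L n)"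
    and sub: "\<And>n. n \<ge> 1 \<Longrightarrow> L n \<subseteq> exponents (tuples k n)"
    and inv: "\<And>n m \<sigma> e. 1 \<le> n \<Longrightarrow> n \<le> m \<Longrightarrow> \<sigma> permutes {1..m} \<Longrightarrow> e \<in> L n \<Longrightarrow>
      perm_exponent \<sigma> e \<in> L m"
  shows "\<exists>N\<ge>1. \<forall>m\<ge>N. \<forall>H. add_subgroup H \<longrightarrow>
    (\<forall>\<sigma> e. \<sigma> permutes {1..m} \<longrightarrow> e \<in> L N \<longrightarrow> perm_exponent \<sigma> e \<in> H) \<longrightarrow> L m \<subseteq> H"
proof (rule ccontr)
  assume contra: "\<not> ?thesis"
  define Q where "Q s m H f \<longleftrightarrow> Suc s \<le> m \<and> add_subgroup H \<and>
      (\<forall>\<sigma> e. \<sigma> permutes {1..m} \<longrightarrow> e \<in> L (Suc s) \<longrightarrow> perm_exponent \<sigma> e \<in> H) \<and>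
      f \<in> L m - H \<and> f \<noteq> 0 \<and> (\<forall>h\<in>L m - H. Poly_Mapping.keys h \<subseteq> {..lead f} \<longrightarrow>
        \<bar>Poly_Mapping.lookup f (lead f)\<bar> \<le> \<bar>Poly_Mapping.lookup h (lead f)\<bar>)" for s m H f
  have "\<exists>m H f. Q s m H f" for s
  proof -
    from contra have "\<not> (\<forall>m\<ge>Suc s. \<forall>H. add_subgroup H \<longrightarrow>
      (\<forall>\<sigma> e. \<sigma> permutes {1..m} \<longrightarrow> e \<in> L (Suc s) \<longrightarrow> perm_exponent \<sigma> e \<in> H) \<longrightarrow> L m \<subseteq> H)"
      using Suc_le_mono[of 0 s] unfolding One_nat_def by blast
    then obtain m H where m: "Suc s \<le> m" and H: "add_subgroup H"
      "\<forall>\<sigma> e. \<sigma> permutes {1..m} \<longrightarrow> e \<in> L (Suc s) \<longrightarrow> perm_exponent \<sigma> e \<in> H"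
      "\<not> L m \<subseteq> H"
      by blast
    have "\<exists>f\<in>L m - H. f \<noteq> 0 \<and> (\<forall>h\<in>L m - H. Poly_Mapping.keys h \<subseteq> {..lead f} \<longrightarrow>
        \<bar>Poly_Mapping.lookup f (lead f)\<bar> \<le> \<bar>Poly_Mapping.lookup h (lead f)\<bar>)"
      by (rule minimal_missing_element[where X = "tuples k m"])
        (use H m sub[of m] finite_tuples in \<open>auto simp: add_subgroup_def\<close>)
    with m H show ?thesis
      unfolding Q_def by blast
  qed
  then obtain m H f where Q: "\<And>s. Q s (m s) (H s) (f s)"
    by metis
  then have m: "\<And>s. Suc s \<le> m s" and H: "\<And>s. add_subgroup (H s)"
    and orbit: "\<And>s \<sigma> e. \<sigma> permutes {1..m s} \<Longrightarrow> e \<in> L (Suc s) \<Longrightarrow> perm_exponent \<sigma> e \<in> H s"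
    and f: "\<And>s. f s \<in> L (m s)" "\<And>s. f s \<notin> H s" "\<And>s. f s \<noteq> 0"
    and least: "\<And>s h. h \<in> L (m s) \<Longrightarrow> h \<notin> H s \<Longrightarrow> Poly_Mapping.keys h \<subseteq> {..lead (f s)} \<Longrightarrow>
      \<bar>Poly_Mapping.lookup (f s) (lead (f s))\<bar> \<le> \<bar>Poly_Mapping.lookup h (lead (f s))\<bar>"
    unfolding Q_def by blast+
  define v where "v s = lead (f s)" for s
  define c where "c s = Poly_Mapping.lookup (f s) (v s)" for s
  have m1: "1 \<le> m s" for s
    using m[of s] by simp
  have keys_f: "Poly_Mapping.keys (f s) \<subseteq> tuples k (m s)" for s
    using sub[OF m1] f(1) by (auto simp: exponents_def)
  have v: "v s \<in> Poly_Mapping.keys (f s)" for s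
    unfolding v_def using f(3) by (rule lead_in_keys)
  then have v_tuple: "v s \<in> tuples k (m s)" for s
    using keys_f by blast
  have c0: "c s \<noteq> 0" for s
    using v by (simp add: c_def in_keys_iff)
  have le_v: "Poly_Mapping.keys (f s) \<subseteq> {..v s}" for s
    unfolding v_def lead_def by auto

  \<comment> \<open>Only finitely many numbers of the vector \<open>f s\<close> matter: its leading coefficient, and the
    relative position of the entries of its leading tuple between the walls.\<close>
  define data where "data s = (\<lambda>x. case x of None \<Rightarrow> nat \<bar>c s\<bar>
    | Some (i, j) \<Rightarrow> Suc (landmark (m s) (v s) j) - landmark (m s) (v s) i)" for s
  define I where "I = insert None (Some ` ({..<k+2} \<times> {..<k+2}))"
  have "finite I"
    by (simp add: I_def)
  from dickson_subseq[OF this, of data] obtain \<phi> :: "nat \<Rightarrow> nat" where \<phi>: "strict_mono \<phi>"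
    "\<And>x s t. x \<in> I \<Longrightarrow> s \<le> t \<Longrightarrow> data (\<phi> s) x \<le> data (\<phi> t) x" by blast
  \<comment> \<open>\<open>H q\<close> is only known to contain the translates of \<open>L (Suc q)\<close>, so \<open>q\<close> has to be
    so late that \<open>f p\<close>, an element of \<open>L (m p)\<close>, is already in \<open>L (Suc q)\<close>.\<close>
  define p where "p = \<phi> 0"
  define q where "q = \<phi> (m p)"
  have q: "m p \<le> q"
    unfolding q_def using \<phi>(1) by (rule strict_mono_imp_increasing)
  then have pq: "m p \<le> m q"
    using m[of q] by simp
  have data: "data p x \<le> data q x" if "x \<in> I" for x
    using \<phi>(2)[OF that, of 0 "m p"] by (simp add: p_def q_def)
  have "Suc (landmark (m p) (v p) j) - landmark (m p) (v p) i \<le>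
      Suc (landmark (m q) (v q) j) - landmark (m q) (v q) i" if "i < k + 2" "j < k + 2" for i j
    using data[of "Some (i, j)"] that by (simp add: I_def data_def image_iff)
  then obtain \<pi> where \<pi>: "strict_mono \<pi>" "\<pi> ` {1..m p} \<subseteq> {1..m q}" "map \<pi> (v p) = v q"
    using strict_mono_between_tuples[of "v p" k "v q" "m p" "m q"] v_tuple
    by (auto simp: tuples_def)
  obtain \<sigma> where \<sigma>: "\<sigma> permutes {1..m q}" "\<And>x. x \<in> {1..m p} \<Longrightarrow> \<sigma> x = \<pi> x"
    using injection_extends_to_permutation[of "{1..m q}" "{1..m p}" \<pi>] \<pi>(1,2) pq
    by (auto simp: strict_mono_imp_inj_on)
  have \<sigma>_tuple: "map \<sigma> u = map \<pi> u" if "u \<in> tuples k (m p)" for u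
    using that \<sigma>(2) by (auto simp: tuples_def)

  define g where "g = perm_exponent \<sigma> (f p)"
  \<comment> \<open>The identity is a permutation, so invariance includes that the lattices increase.\<close>
  have "perm_exponent id (f p) \<in> L (Suc q)"
    using m1[of p] q f(1)[of p] by (intro inv[of "m p"]) (auto simp: permutes_id)
  then have gH: "g \<in> H q"
    unfolding g_def perm_exponent_id by (rule orbit[OF \<sigma>(1)])
  have gL: "g \<in> L (m q)"
    unfolding g_def using m1[of p] pq \<sigma>(1) f(1)[of p] by (rule inv)
  have g_le: "Poly_Mapping.keys g \<subseteq> {..v q}"
  proof
    fix w assume "w \<in> Poly_Mapping.keys g"
    then obtain u where u: "u \<in> Poly_Mapping.keys (f p)" "w = map \<sigma> u"
      using keys_perm_exponent[of \<sigma> "f p"] by (auto simp: g_def)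
    then have "w = map \<pi> u"
      using \<sigma>_tuple keys_f by blast
    moreover have "map \<pi> u \<le> map \<pi> (v p)"
      using \<pi>(1) u(1) le_v by (intro map_strict_mono_le) auto
    ultimately show "w \<in> {..v q}"
      using \<pi>(3) by simp
  qed
  have g_lc: "Poly_Mapping.lookup g (v q) = c p"
    using lookup_perm_exponent[OF permutes_inj[OF \<sigma>(1)], of "f p" "v p"]
      \<sigma>_tuple[OF v_tuple] \<pi>(3) by (simp add: g_def c_def)
  \<comment> \<open>Depending on the signs, subtracting or adding \<open>g\<close> brings the leading coefficient closer
    to \<open>0\<close>, but minimality of \<open>f q\<close> forbids both.\<close>
  have "\<bar>c p\<bar> \<le> \<bar>c q\<bar>"
    using data[of None] by (simp add: I_def data_def)
  with c0[of p] have "\<bar>c q - c p\<bar> < \<bar>c q\<bar> \<or> \<bar>c q + c p\<bar> < \<bar>c q\<bar>"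
    by linarith
  moreover have "\<bar>c q\<bar> \<le> \<bar>c q - c p\<bar>"
  proof -
    have "f q - g \<notin> H q"
      using add_subgroup_add[OF H _ gH, of "f q - g"] f(2)[of q] by auto
    moreover have "f q - g \<in> L (m q)"
      using grp[OF m1] f(1) gL by (simp add: add_subgroup_def)
    moreover have "Poly_Mapping.keys (f q - g) \<subseteq> {..lead (f q)}"
      using keys_diff[of "f q" g] g_le le_v[of q] by (auto simp: v_def)
    ultimately have "\<bar>Poly_Mapping.lookup (f q) (lead (f q))\<bar> \<le>
        \<bar>Poly_Mapping.lookup (f q - g) (lead (f q))\<bar>"
      by (intro least)
    then show ?thesis
      using g_lc by (simp add: lookup_minus c_def v_def)
  qed
  moreover have "\<bar>c q\<bar> \<le> \<bar>c q + c p\<bar>"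
  proof -
    have "f q + g \<notin> H q"
      using H[of q] gH f(2)[of q] unfolding add_subgroup_def by (metis add_diff_cancel_right')
    moreover have "f q + g \<in> L (m q)"
      using grp[OF m1] f(1) gL by (intro add_subgroup_add)
    moreover have "Poly_Mapping.keys (f q + g) \<subseteq> {..lead (f q)}"
      using Poly_Mapping.keys_add[of "f q" g] g_le le_v[of q] by (auto simp: v_def)
    ultimately have "\<bar>Poly_Mapping.lookup (f q) (lead (f q))\<bar> \<le>
        \<bar>Poly_Mapping.lookup (f q + g) (lead (f q))\<bar>"
      by (intro least)
    then show ?thesis
      using g_lc by (simp add: lookup_add c_def v_def)
  qed
  ultimately show False by linarith
qed

section \<open>From Laurent lattice ideals to lattices\<close>

text \<open>
  The set of exponents is not restricted to \<open>exponents V\<close> here; for an ideal of \<open>laurent_ring V\<close>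
  this restriction is automatic.
\<close>

definition ideal_lattice :: "('v, 'a::field) laurent set \<Rightarrow> ('v \<Rightarrow>\<^sub>0 int) set" where
  "ideal_lattice J = {e. monomial e - 1 \<in> J}"

lemma monomial_zero: "monomial 0 = (1 :: ('v, 'a::field) laurent)"
  by (simp add: monomial_def)

lemma laurent_ring_simps:
  "zero (laurent_ring V) = (0 :: ('v, 'a::field) laurent)"
  "one (laurent_ring V) = (1 :: ('v, 'a::field) laurent)"
  "add (laurent_ring V) p q = (p + q :: ('v, 'a::field) laurent)"
  "monoid.mult (laurent_ring V) p q = (p * q :: ('v, 'a::field) laurent)"
  "p \<in> carrier (laurent_ring V) \<longleftrightarrow> Poly_Mapping.keys (p :: ('v, 'a::field) laurent) \<subseteq> exponents V"
  by (simp_all add: laurent_ring_def monoid_algebra_def)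

lemma poly_ring_simps:
  "zero (poly_ring V) = (0 :: ('v, 'a::field) laurent)"
  "one (poly_ring V) = (1 :: ('v, 'a::field) laurent)"
  "add (poly_ring V) p q = (p + q :: ('v, 'a::field) laurent)"
  "monoid.mult (poly_ring V) p q = (p * q :: ('v, 'a::field) laurent)"
  "p \<in> carrier (poly_ring V) \<longleftrightarrow>
     Poly_Mapping.keys (p :: ('v, 'a::field) laurent) \<subseteq> nonneg_exponents V"
  by (simp_all add: poly_ring_def monoid_algebra_def)

lemma keys_monomial: "Poly_Mapping.keys (monomial e :: ('v, 'a::field) laurent) = {e}"
  by (simp add: monomial_def)

lemma keys_neg: "Poly_Mapping.keys (- p) = Poly_Mapping.keys (p :: 'b \<Rightarrow>\<^sub>0 'c::ab_group_add)"
  by (auto simp: in_keys_iff)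

lemma laurent_ideal_closed:
  fixes J :: "('v, 'a::field) laurent set"
  assumes "ideal J (laurent_ring V)"
  shows "0 \<in> J" "p \<in> J \<Longrightarrow> q \<in> J \<Longrightarrow> p + q \<in> J"
    "p \<in> J \<Longrightarrow> Poly_Mapping.keys p \<subseteq> exponents V"
    "p \<in> J \<Longrightarrow> Poly_Mapping.keys r \<subseteq> exponents V \<Longrightarrow> r * p \<in> J"
    "p \<in> J \<Longrightarrow> - p \<in> J"
proof -
  interpret J: ideal J "laurent_ring V" by fact
  show "0 \<in> J"
    using additive_subgroup.zero_closed[OF J.additive_subgroup_axioms] by (simp add: laurent_ring_simps)
  show "p \<in> J \<Longrightarrow> q \<in> J \<Longrightarrow> p + q \<in> J"
    using additive_subgroup.a_closed[OF J.additive_subgroup_axioms, of p q] by (simp add: laurent_ring_simps)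
  show "p \<in> J \<Longrightarrow> Poly_Mapping.keys p \<subseteq> exponents V"
    using J.Icarr[of p] by (simp add: laurent_ring_simps)
  show mult: "p \<in> J \<Longrightarrow> Poly_Mapping.keys r \<subseteq> exponents V \<Longrightarrow> r * p \<in> J" for r
    using J.I_l_closed[of p r] by (simp add: laurent_ring_simps)
  show "p \<in> J \<Longrightarrow> - p \<in> J"
    using mult[of "- 1"] by (simp add: exponents_def keys_neg)
qed

lemma ideal_lattice_subset_exponents:
  fixes J :: "('v, 'a::field) laurent set"
  assumes "ideal J (laurent_ring V)"
  shows "ideal_lattice J \<subseteq> exponents V"
proof
  fix e assume "e \<in> ideal_lattice J"
  then have keys: "Poly_Mapping.keys (monomial e - 1 :: ('v, 'a) laurent) \<subseteq> exponents V"
    using laurent_ideal_closed(3)[OF assms] by (simp add: ideal_lattice_def)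
  show "e \<in> exponents V"
  proof (cases "e = 0")
    case False
    then have "e \<in> Poly_Mapping.keys (monomial e - 1 :: ('v, 'a) laurent)"
      by (simp add: in_keys_iff lookup_minus monomial_def lookup_one)
    with keys show ?thesis by blast
  qed (simp add: exponents_def)
qed

lemma add_subgroup_ideal_lattice:
  fixes J :: "('v, 'a::field) laurent set"
  assumes "ideal J (laurent_ring V)"
  shows "add_subgroup (ideal_lattice J)"
  unfolding add_subgroup_def
proof (intro conjI ballI)
  note closed = laurent_ideal_closed[OF assms]
  show "0 \<in> ideal_lattice J"
    using closed(1) by (simp add: ideal_lattice_def monomial_zero)
  fix a b assume ab: "a \<in> ideal_lattice J" "b \<in> ideal_lattice J"
  then have "b \<in> exponents V"
    using ideal_lattice_subset_exponents[OF assms] by auto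
  then have "Poly_Mapping.keys (monomial (- b) :: ('v, 'a) laurent) \<subseteq> exponents V"
    by (simp add: keys_monomial exponents_def)
  \<comment> \<open>\<open>x\<^bsup>a-b\<^esup> - 1\<close> is \<open>x\<^bsup>-b\<^esup>\<close> times the difference of \<open>x\<^sup>a - 1\<close> and \<open>x\<^sup>b - 1\<close>.\<close>
  then have "monomial (- b) * (monomial a - 1) + - (monomial (- b) * (monomial b - 1)) \<in> J"
    using ab unfolding ideal_lattice_def by (intro closed(2) closed(5) closed(4)) simp_all
  moreover have "monomial (- b) * (monomial a - 1) + - (monomial (- b) * (monomial b - 1)) =
      (monomial (a - b) - 1 :: ('v, 'a) laurent)"
    by (simp add: right_diff_distrib monomial_mult monomial_zero)
  ultimately show "a - b \<in> ideal_lattice J"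
    by (simp add: ideal_lattice_def)
qed

text \<open>
  The lattice ideal is generated inside the polynomial ring, so minimality of the generated ideal is
  applied to the contraction \<open>P\<close> of \<open>J\<close> to that ring; it contains the generators because
  \<open>x\<^sup>u - x\<^sup>v = x\<^sup>v (x\<^bsup>u-v\<^esup> - 1)\<close>.
\<close>

lemma laurent_extension_subset_ideal:
  fixes J :: "('v, 'a::field) laurent set"
  assumes J: "ideal J (laurent_ring V)" and L: "L \<subseteq> ideal_lattice J"
  shows "laurent_extension V (lattice_ideal V L) \<subseteq> J"
proof -
  note closed = laurent_ideal_closed[OF J]
  define P where "P = {p \<in> J. Poly_Mapping.keys p \<subseteq> nonneg_exponents V}"
  interpret R: cring "poly_ring V :: ('v, 'a) laurent ring"
    by (rule cring_poly_ring)
  have PJ: "p \<in> P \<longleftrightarrow> p \<in> J \<and> p \<in> carrier (poly_ring V)" for p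
    by (simp add: P_def poly_ring_simps)
  have mult: "r * p \<in> P" if "p \<in> P" "r \<in> carrier (poly_ring V)" for p r
  proof -
    have "Poly_Mapping.keys r \<subseteq> exponents V"
      using that(2) by (auto simp: poly_ring_simps nonneg_exponents_def)
    then show ?thesis
      using that R.m_closed[of r p] closed(4)[of p r] by (simp add: PJ poly_ring_simps(4))
  qed
  have "ideal P (poly_ring V)"
  proof (rule idealI)
    show "subgroup P (add_monoid (poly_ring V))"
    proof (rule R.add.subgroupI)
      show "P \<noteq> {}"
        using closed(1) by (auto simp: P_def)
      fix p q assume p: "p \<in> P" and q: "q \<in> P"
      have "\<ominus>\<^bsub>poly_ring V\<^esub> p = - p"
        using p by (intro R.minus_equality) (auto simp: P_def poly_ring_simps keys_neg)
      then show "\<ominus>\<^bsub>poly_ring V\<^esub> p \<in> P"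
        using p closed(5) by (simp add: P_def keys_neg)
      show "p \<oplus>\<^bsub>poly_ring V\<^esub> q \<in> P"
        using p q closed(2) R.a_closed[of p q] by (simp add: PJ poly_ring_simps(3))
    qed (auto simp: PJ)
  qed (use mult R.ring_axioms in \<open>auto simp: poly_ring_simps(4) mult.commute\<close>)
  moreover have "monomial u - monomial v \<in> P"
    if uv: "u \<in> nonneg_exponents V" "v \<in> nonneg_exponents V" "u - v \<in> L" for u v
  proof -
    have "monomial v * (monomial (u - v) - 1) \<in> J"
      using uv L by (intro closed(4))
        (auto simp: ideal_lattice_def keys_monomial nonneg_exponents_def)
    then have "monomial u - monomial v \<in> J"
      by (simp add: right_diff_distrib monomial_mult)
    then show ?thesis
      using uv keys_diff[of "monomial u :: ('v, 'a) laurent" "monomial v"]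
      by (auto simp: P_def keys_monomial)
  qed
  ultimately have "lattice_ideal V L \<subseteq> P"
    unfolding lattice_ideal_def by (intro R.genideal_minimal) auto
  moreover have "g * monomial (- e) \<in> J" if "g \<in> P" "e \<in> nonneg_exponents V" for g e
    using that closed(4)[of g "monomial (- e)"]
    by (simp add: P_def keys_monomial nonneg_exponents_def exponents_def mult.commute keys_neg)
  ultimately show ?thesis
    by (auto simp: laurent_extension_def)
qed

text \<open>
  Write \<open>e = u - v\<close> with \<open>u\<close> the positive and \<open>v\<close> the negative part of \<open>e\<close>; then \<open>x\<^sup>e - 1\<close> is
  \<open>(x\<^sup>u - x\<^sup>v) x\<^bsup>-v\<^esup>\<close>.
\<close>

lemma lattice_subset_ideal_lattice:
  assumes "subgroup L (exponent_group V)"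
  shows "L \<subseteq> ideal_lattice (laurent_extension V (lattice_ideal V L) :: ('v, 'a::field) laurent set)"
proof
  fix e assume e: "e \<in> L"
  interpret R: cring "poly_ring V :: ('v, 'a) laurent ring"
    by (rule cring_poly_ring)
  have "e \<in> exponents V"
    using subgroup.subset[OF assms] e by (auto simp: exponent_group_def)
  define u where "u = Poly_Mapping.map (max 0) e"
  define v where "v = u - e"
  have lookup_u: "Poly_Mapping.lookup u x = max 0 (Poly_Mapping.lookup e x)" for x
    by (simp add: u_def Poly_Mapping.map.rep_eq when_def)
  have uv: "u \<in> nonneg_exponents V" "v \<in> nonneg_exponents V"
    using \<open>e \<in> exponents V\<close>
    by (auto simp: nonneg_exponents_def exponents_def in_keys_iff lookup_u v_def lookup_minus
        max_def subset_iff split: if_splits)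
  let ?S = "{monomial u - monomial v | u v. u \<in> nonneg_exponents V \<and>
    v \<in> nonneg_exponents V \<and> u - v \<in> L} :: ('v, 'a) laurent set"
  have "?S \<subseteq> carrier (poly_ring V)"
  proof clarify
    fix u v assume "u \<in> nonneg_exponents V" "v \<in> nonneg_exponents V"
    then show "monomial u - monomial v \<in> carrier (poly_ring V :: ('v, 'a) laurent ring)"
      using keys_diff[of "monomial u :: ('v, 'a) laurent" "monomial v"]
      by (auto simp: poly_ring_simps keys_monomial)
  qed
  then have "?S \<subseteq> lattice_ideal V L"
    unfolding lattice_ideal_def by (rule R.genideal_self)
  moreover have "monomial u - monomial v \<in> ?S"
    using uv e by (intro CollectI exI[of _ u] exI[of _ v]) (simp add: v_def)
  ultimately have "(monomial u - monomial v) * monomial (- v) \<in>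
      (laurent_extension V (lattice_ideal V L) :: ('v, 'a) laurent set)"
    using uv(2) unfolding laurent_extension_def by blast
  moreover have "(monomial u - monomial v) * monomial (- v) = (monomial e - 1 :: ('v, 'a) laurent)"
    by (simp add: left_diff_distrib monomial_mult monomial_zero v_def)
  ultimately show "e \<in> ideal_lattice (laurent_extension V (lattice_ideal V L) :: ('v, 'a) laurent set)"
    by (simp add: ideal_lattice_def)
qed

text \<open>
  A Laurent lattice ideal is determined by its lattice, and inclusions can be tested on lattices.
\<close>

lemma laurent_lattice_ideal_subset:
  fixes J K :: "('v, 'a::field) laurent set"
  assumes "laurent_lattice_ideal V J" "ideal K (laurent_ring V)"
    and "ideal_lattice J \<subseteq> ideal_lattice K"
  shows "J \<subseteq> K"
proof -
  from assms(1) obtain L where L: "subgroup L (exponent_group V)"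
    "J = laurent_extension V (lattice_ideal V L)"
    by (auto simp: laurent_lattice_ideal_def)
  then have "L \<subseteq> ideal_lattice J"
    using lattice_subset_ideal_lattice[OF L(1)] by simp
  with assms(3) have "L \<subseteq> ideal_lattice K" by blast
  with assms(2) show ?thesis
    unfolding L(2) by (rule laurent_extension_subset_ideal)
qed

lemma perm_act_monomial_minus_one:
  "perm_act \<sigma> (monomial e - 1 :: (nat list, 'a::field) laurent) = monomial (perm_exponent \<sigma> e) - 1"
proof -
  have "monomial e - 1 = Poly_Mapping.single e 1 + (Poly_Mapping.single 0 (- 1) :: (nat list, 'a) laurent)"
    by (simp add: monomial_def single_uminus)
  then have "perm_act \<sigma> (monomial e - 1 :: (nat list, 'a) laurent) =
      Poly_Mapping.single (perm_exponent \<sigma> e) 1 + Poly_Mapping.single (perm_exponent \<sigma> 0) (- 1)"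
    by (simp only: perm_act_add perm_act_single)
  then show ?thesis
    by (simp add: monomial_def perm_exponent_def single_uminus)
qed

text \<open>
  A common statement for all tuples and for tuples with distinct entries: the lattices of \<open>J n\<close> are
  supported on \<open>T n\<close>, hence on \<open>tuples k n\<close>, and their invariance is inherited from the ideals.
\<close>

lemma laurent_lattice_chain_stabilizes:
  fixes J :: "nat \<Rightarrow> (nat list, 'a::field) laurent set"
  assumes T: "\<And>n. T n \<subseteq> tuples k n"
    and chain: "invariant_chain (\<lambda>n. laurent_ring (T n)) J"
    and lattice: "\<And>n. n \<ge> 1 \<Longrightarrow> laurent_lattice_ideal (T n) (J n)"
  shows "stabilizes (\<lambda>n. laurent_ring (T n)) J"
proof -
  have J: "ideal (J n) (laurent_ring (T n))" if "1 \<le> n" for n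
    using chain that by (simp add: invariant_chain_def)
  have inv: "perm_act \<sigma> g \<in> J m" if "1 \<le> n" "n \<le> m" "\<sigma> permutes {1..m}" "g \<in> J n" for n m \<sigma> g
    using chain that unfolding invariant_chain_def by blast
  have "\<exists>N\<ge>1. \<forall>m\<ge>N. \<forall>H. add_subgroup H \<longrightarrow>
    (\<forall>\<sigma> e. \<sigma> permutes {1..m} \<longrightarrow> e \<in> ideal_lattice (J N) \<longrightarrow> perm_exponent \<sigma> e \<in> H) \<longrightarrow>
    ideal_lattice (J m) \<subseteq> H"
  proof (rule lattice_chain_stabilizes)
    fix n :: nat assume n: "1 \<le> n"
    show "add_subgroup (ideal_lattice (J n))"
      using J[OF n] by (rule add_subgroup_ideal_lattice)
    show "ideal_lattice (J n) \<subseteq> exponents (tuples k n)"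
      using ideal_lattice_subset_exponents[OF J[OF n]] T[of n] by (auto simp: exponents_def)
    show "perm_exponent \<sigma> e \<in> ideal_lattice (J m)"
      if "n \<le> m" "\<sigma> permutes {1..m}" "e \<in> ideal_lattice (J n)" for m \<sigma> e
      using inv[OF n that(1,2), of "monomial e - 1"] that(3)
      by (simp add: ideal_lattice_def perm_act_monomial_minus_one)
  qed
  then obtain N where N: "1 \<le> N" and stab: "\<forall>m\<ge>N. \<forall>H. add_subgroup H \<longrightarrow>
    (\<forall>\<sigma> e. \<sigma> permutes {1..m} \<longrightarrow> e \<in> ideal_lattice (J N) \<longrightarrow> perm_exponent \<sigma> e \<in> H) \<longrightarrow>
    ideal_lattice (J m) \<subseteq> H"
    by (elim exE conjE)
  have gen: "ideal_lattice (J m) \<subseteq> H" if "N \<le> m" "add_subgroup H"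
    "\<And>\<sigma> e. \<sigma> permutes {1..m} \<Longrightarrow> e \<in> ideal_lattice (J N) \<Longrightarrow> perm_exponent \<sigma> e \<in> H" for m H
    using stab that by simp
  have "Idl\<^bsub>laurent_ring (T m)\<^esub> {perm_act \<sigma> g | \<sigma> g. \<sigma> permutes {1..m} \<and> g \<in> J N} = J m"
    if m: "N \<le> m" for m
  proof
    let ?S = "{perm_act \<sigma> g | \<sigma> g. \<sigma> permutes {1..m} \<and> g \<in> J N}"
    let ?K = "Idl\<^bsub>laurent_ring (T m)\<^esub> ?S"
    interpret R: cring "laurent_ring (T m) :: (nat list, 'a) laurent ring"
      by (rule cring_laurent_ring)
    have Jm: "ideal (J m) (laurent_ring (T m))"
      using J N m by simp
    have S: "?S \<subseteq> J m"
      using inv[OF N m] by blast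
    show "?K \<subseteq> J m"
      using Jm S by (rule R.genideal_minimal)
    have carrier: "?S \<subseteq> carrier (laurent_ring (T m))"
      using S ideal.Icarr[OF Jm] by blast
    then have K: "ideal ?K (laurent_ring (T m))"
      by (rule R.genideal_ideal)
    have "?S \<subseteq> ?K"
      using carrier by (rule R.genideal_self)
    have "perm_exponent \<sigma> e \<in> ideal_lattice ?K"
      if "\<sigma> permutes {1..m}" "e \<in> ideal_lattice (J N)" for \<sigma> e
    proof -
      have "perm_act \<sigma> (monomial e - 1) \<in> ?S"
        using that unfolding ideal_lattice_def by blast
      then have "perm_act \<sigma> (monomial e - 1) \<in> ?K"
        using \<open>?S \<subseteq> ?K\<close> by (rule rev_subsetD)
      then show ?thesis
        by (simp only: ideal_lattice_def mem_Collect_eq perm_act_monomial_minus_one)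
    qed
    then have "ideal_lattice (J m) \<subseteq> ideal_lattice ?K"
      by (rule gen[OF m add_subgroup_ideal_lattice[OF K]])
    then show "J m \<subseteq> ?K"
      using lattice N m K by (intro laurent_lattice_ideal_subset) auto
  qed
  with N show ?thesis
    unfolding stabilizes_def by blast
qed

theorem theorem1p3:
  fixes k :: nat
  assumes "k \<ge> 1"
  shows "(\<forall>J :: nat \<Rightarrow> (nat list, 'a::field) laurent set.
            invariant_chain (\<lambda>n. laurent_ring (tuples k n)) J \<and>
            (\<forall>n\<ge>1. laurent_lattice_ideal (tuples k n) (J n)) \<longrightarrow>
            stabilizes (\<lambda>n. laurent_ring (tuples k n)) J) \<and>
         (\<forall>J :: nat \<Rightarrow> (nat list, 'a::field) laurent set.
            invariant_chain (\<lambda>n. laurent_ring (distinct_tuples k n)) J \<and>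
            (\<forall>n\<ge>1. laurent_lattice_ideal (distinct_tuples k n) (J n)) \<longrightarrow>
            stabilizes (\<lambda>n. laurent_ring (distinct_tuples k n)) J)"
  by (intro conjI allI impI; rule laurent_lattice_chain_stabilizes[where k = k])
    (auto simp: distinct_tuples_def)

end
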